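(* Let $E$ be a Euclidean space with $\dim E\ge 2$ and consider the Newtonian $N$-body problem in $E$ with masses $m_1,\dots,m_N>0$. For every configuration without collisions $a\in\Omega$ there is a hyperbolic motion with zero angular momentum and asymptotic velocity $a$, that is, with $\dot x(t)\to a$ as $t\to+\infty$.
   Context: $E$ is a finite-dimensional Euclidean space, $N\ge 2$, $m_1,\dots,m_N>0$. For $x=(r_1,\dots,r_N),\,y=(s_1,\dots,s_N)\in E^N$ the mass inner product is $\langle x,y\rangle=\sum_i m_i\langle r_i,s_i\rangle_E$. The Newtonian potential is $U(x)=\sum_{i<j}m_im_j\|r_i-r_j\|_E^{-1}\in(0,+\infty]$, and $\Omega=\{x\in E^N: U(x)<+\infty\}$ is the set of configurations without collisions. Newton's equations are $\ddot x=\nabla U(x)$ on $\Omega$, the gradient being taken with respect to the mass inner product. A hyperbolic motion is a solution $x(t)=(r_1(t),\dots,r_N(t))\in\Omega$ of Newton's equations, defined for all sufficiently large $t$ (without singularities in the future), such that $\dot r_i(t)\to a_i\in E$ as $t\to+\infty$ with $a_i\ne a_j$ for $i\neq j$; $a=(a_1,\dots,a_N)$ is its asymptotic velocity. The angular momentum of a motion is the constant $\sum_i m_i\, r_i\wedge\dot r_i\in\Lambda^2E$. *)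

theory Defs
  imports "HOL-Analysis.Analysis"
begin

section \<open>The second exterior power\<close>

text \<open>
  \<open>\<Lambda>\<^sup>2E\<close> is realised as the space of alternating bilinear forms on \<open>E\<^sup>*\<close>, with \<open>E\<^sup>*\<close> identified
  with \<open>E\<close> through the inner product. Lemma \<open>wedge_universal\<close> below shows that this space,
  together with \<open>\<and>\<close>, has the universal property which characterises \<open>\<Lambda>\<^sup>2E\<close>.
\<close>

typedef (overloaded) 'e bivector =
  "{B :: 'e::euclidean_space \<Rightarrow> 'e \<Rightarrow> real. bilinear B \<and> (\<forall>u. B u u = 0)}"
  morphisms bivector_form Bivector
  by (rule exI[of _ "\<lambda>u v. 0"]) (auto simp: bilinear_def linear_iff)

setup_lifting type_definition_bivector

instantiation bivector :: (euclidean_space) real_vector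
begin

lift_definition zero_bivector :: "'a bivector" is "\<lambda>u v. 0"
  by (auto simp: bilinear_def linear_iff)

lift_definition plus_bivector :: "'a bivector \<Rightarrow> 'a bivector \<Rightarrow> 'a bivector"
  is "\<lambda>A B u v. A u v + B u v"
  by (auto simp: bilinear_def linear_iff algebra_simps)

lift_definition minus_bivector :: "'a bivector \<Rightarrow> 'a bivector \<Rightarrow> 'a bivector"
  is "\<lambda>A B u v. A u v - B u v"
  by (auto simp: bilinear_def linear_iff algebra_simps)

lift_definition uminus_bivector :: "'a bivector \<Rightarrow> 'a bivector" is "\<lambda>A u v. - A u v"
  by (auto simp: bilinear_def linear_iff algebra_simps)

lift_definition scaleR_bivector :: "real \<Rightarrow> 'a bivector \<Rightarrow> 'a bivector"
  is "\<lambda>c A u v. c * A u v"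
  by (auto simp: bilinear_def linear_iff algebra_simps)

instance
  by standard (transfer; auto simp: algebra_simps fun_eq_iff)+

end

lift_definition wedge :: "'e::euclidean_space \<Rightarrow> 'e \<Rightarrow> 'e bivector"  (infixr "\<and>\<^sub>E" 75)
  is "\<lambda>a b u v. inner a u * inner b v - inner a v * inner b u"
  by (auto simp: bilinear_def linear_iff inner_simps algebra_simps)

lemma wedge_bilinear: "bilinear (wedge :: 'e::euclidean_space \<Rightarrow> _)"
  unfolding bilinear_def linear_iff
  by (intro conjI allI; transfer; auto simp: inner_simps algebra_simps fun_eq_iff)

lemma wedge_self: "a \<and>\<^sub>E a = 0"
  by transfer (auto simp: algebra_simps)

lemma bivector_form_sum: "bivector_form (sum f S) u v = (\<Sum>i\<in>S. bivector_form (f i) u v)"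
  by (induction S rule: infinite_finite_induct)
     (auto simp: zero_bivector.rep_eq plus_bivector.rep_eq)

lemma bivector_expansion:
  fixes B :: "'e::euclidean_space bivector"
  shows "B = (\<Sum>b\<in>Basis. \<Sum>c\<in>Basis. (bivector_form B b c / 2) *\<^sub>R (b \<and>\<^sub>E c))"
proof -
  have bil: "bilinear (bivector_form B)" and alt: "\<And>u. bivector_form B u u = 0"
    using bivector_form[of B] by auto
  have anti: "bivector_form B u v = - bivector_form B v u" for u v
  proof -
    have "bivector_form B (u + v) (u + v) = bivector_form B u v + bivector_form B v u"
      by (simp only: bilinear_ladd[OF bil] bilinear_radd[OF bil] alt[of u] alt[of v] add_0_left add_0_right)
    then show ?thesis using alt[of "u + v"] by linarith
  qed
  have exp: "bivector_form B u v
      = (\<Sum>b\<in>Basis. \<Sum>c\<in>Basis. bivector_form B b c * (inner b u * inner c v))" for u v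
  proof -
    have "bivector_form B u v = bivector_form B (\<Sum>b\<in>Basis. inner u b *\<^sub>R b) (\<Sum>c\<in>Basis. inner v c *\<^sub>R c)"
      by (simp add: euclidean_representation)
    also have "\<dots> = (\<Sum>(b,c)\<in>Basis \<times> Basis. bivector_form B (inner u b *\<^sub>R b) (inner v c *\<^sub>R c))"
      by (rule bilinear_sum[OF bil])
    also have "\<dots> = (\<Sum>b\<in>Basis. \<Sum>c\<in>Basis. bivector_form B b c * (inner b u * inner c v))"
      by (simp add: sum.cartesian_product bilinear_lmul[OF bil] bilinear_rmul[OF bil]
            inner_commute mult_ac)
    finally show ?thesis .
  qed
  have "bivector_form B u v = bivector_form
      (\<Sum>b\<in>Basis. \<Sum>c\<in>Basis. (bivector_form B b c / 2) *\<^sub>R (b \<and>\<^sub>E c)) u v" for u v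
  proof -
    have "bivector_form B u v = (bivector_form B u v - bivector_form B v u) / 2"
      using anti[of u v] by simp
    also have "\<dots> = (\<Sum>b\<in>Basis. \<Sum>c\<in>Basis. bivector_form B b c / 2
        * (inner b u * inner c v - inner b v * inner c u))"
      unfolding exp[of u v] exp[of v u]
      by (simp only: sum_subtractf[symmetric] sum_divide_distrib, intro sum.cong refl, simp add: algebra_simps diff_divide_distrib)
    finally show ?thesis
      by (simp add: bivector_form_sum scaleR_bivector.rep_eq wedge.rep_eq)
  qed
  then show ?thesis
    by (intro bivector_form_inject[THEN iffD1] ext)
qed

lemma wedge_universal:
  fixes f :: "'e::euclidean_space \<Rightarrow> 'e \<Rightarrow> 'f::real_vector"
  assumes bil: "bilinear f" and alt: "\<And>u. f u u = 0"
  shows "\<exists>!g :: 'e bivector \<Rightarrow> 'f. linear g \<and> (\<forall>a b. g (a \<and>\<^sub>E b) = f a b)"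
proof (rule ex1I)
  define g where "g = (\<lambda>B. \<Sum>b\<in>Basis. \<Sum>c\<in>Basis. (bivector_form B b c / 2) *\<^sub>R f b c)"
  have anti: "f u v = - f v u" for u v
  proof -
    have "f (u + v) (u + v) = f u v + f v u"
      by (simp only: bilinear_ladd[OF bil] bilinear_radd[OF bil] alt[of u] alt[of v]) simp
    then show ?thesis using alt[of "u + v"] by (simp add: eq_neg_iff_add_eq_0)
  qed
  have lin: "linear g"
    unfolding g_def linear_iff
    by (auto simp: plus_bivector.rep_eq scaleR_bivector.rep_eq scaleR_add_left
          add_divide_distrib sum.distrib scaleR_sum_right)
  have exp: "f u v = (\<Sum>b\<in>Basis. \<Sum>c\<in>Basis. (inner u b * inner v c) *\<^sub>R f b c)" for u v
  proof -
    have "f u v = f (\<Sum>b\<in>Basis. inner u b *\<^sub>R b) (\<Sum>c\<in>Basis. inner v c *\<^sub>R c)"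
      by (simp add: euclidean_representation)
    also have "\<dots> = (\<Sum>(b,c)\<in>Basis \<times> Basis. f (inner u b *\<^sub>R b) (inner v c *\<^sub>R c))"
      by (rule bilinear_sum[OF bil])
    also have "\<dots> = (\<Sum>b\<in>Basis. \<Sum>c\<in>Basis. (inner u b * inner v c) *\<^sub>R f b c)"
      by (simp add: sum.cartesian_product bilinear_lmul[OF bil] bilinear_rmul[OF bil] mult_ac)
    finally show ?thesis .
  qed
  have "g (u \<and>\<^sub>E v) = f u v" for u v
  proof -
    have "2 *\<^sub>R g (u \<and>\<^sub>E v) = f u v - f v u"
      unfolding exp[of u v] exp[of v u] g_def
      by (simp only: wedge.rep_eq sum_subtractf[symmetric] scaleR_sum_right, intro sum.cong refl,
          simp add: scaleR_diff_left[symmetric] inner_commute mult.commute)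
    also have "\<dots> = 2 *\<^sub>R f u v"
      using anti[of v u] by (simp add: scaleR_2)
    finally show ?thesis by simp
  qed
  with lin show "linear g \<and> (\<forall>a b. g (a \<and>\<^sub>E b) = f a b)" by blast
  fix h assume h: "linear h \<and> (\<forall>a b. h (a \<and>\<^sub>E b) = f a b)"
  have "h B = g B" for B
  proof -
    have "h B = h (\<Sum>b\<in>Basis. \<Sum>c\<in>Basis. (bivector_form B b c / 2) *\<^sub>R (b \<and>\<^sub>E c))"
      by (rule arg_cong[OF bivector_expansion])
    also have "\<dots> = g B"
      using h by (simp only: g_def linear_sum[of h] linear_cmul[of h])
    finally show ?thesis .
  qed
  then show "h = g" by blast
qed


section \<open>The Newtonian \<open>N\<close>-body problem\<close>

text \<open>
  The bodies are labelled by a finite linearly ordered type \<open>'n\<close>, so that \<open>E\<^sup>N\<close> is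
  \<open>'e ^ 'n\<close> with \<open>N = CARD('n)\<close>. The order serves only to write the sum over \<open>i < j\<close>.
\<close>

definition mass_inner :: "('n::finite \<Rightarrow> real) \<Rightarrow> 'e::euclidean_space ^ 'n \<Rightarrow> 'e ^ 'n \<Rightarrow> real" where
  "mass_inner m x y = (\<Sum>i\<in>UNIV. m i * inner (x $ i) (y $ i))"

text \<open>At a collision the corresponding summand is \<open>\<infinity>\<close>, since \<open>inverse 0 = \<infinity>\<close> in \<open>ereal\<close>.\<close>

definition newton_potential ::
    "('n::{finite,linorder} \<Rightarrow> real) \<Rightarrow> 'e::euclidean_space ^ 'n::{finite,linorder} \<Rightarrow> ereal" where
  "newton_potential m x =
     (\<Sum>(i, j) \<in> {(i, j). i < j}. ereal (m i * m j) * inverse (ereal (norm (x $ i - x $ j))))"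

definition collision_free ::
    "('n::{finite,linorder} \<Rightarrow> real) \<Rightarrow> ('e::euclidean_space ^ 'n::{finite,linorder}) set" where
  "collision_free m = {x. newton_potential m x < \<infinity>}"

definition has_mass_gradient ::
    "('n::finite \<Rightarrow> real) \<Rightarrow> ('e::euclidean_space ^ 'n \<Rightarrow> real) \<Rightarrow> 'e ^ 'n \<Rightarrow> 'e ^ 'n \<Rightarrow> bool" where
  "has_mass_gradient m f g x \<longleftrightarrow> (f has_derivative mass_inner m g) (at x)"

abbreviation velocity :: "(real \<Rightarrow> 'v::real_normed_vector) \<Rightarrow> real \<Rightarrow> 'v" where
  "velocity x t \<equiv> vector_derivative x (at t)"

text \<open>
  \<open>real_of_ereal\<close> sends \<open>\<infinity>\<close> to \<open>0\<close>; this is harmless because \<open>collision_free m\<close> is open, and so the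
  potential is finite near \<open>x t\<close>.
\<close>

definition newton_solution ::
    "('n::{finite,linorder} \<Rightarrow> real) \<Rightarrow> real set \<Rightarrow> (real \<Rightarrow> 'e::euclidean_space ^ 'n::{finite,linorder}) \<Rightarrow> bool" where
  "newton_solution m T x \<longleftrightarrow>
     (\<forall>t\<in>T. x t \<in> collision_free m \<and> x differentiable (at t) \<and>
        (\<exists>g. has_mass_gradient m (\<lambda>y. real_of_ereal (newton_potential m y)) g (x t) \<and>
             (velocity x has_vector_derivative g) (at t)))"

text \<open>The time domain is \<open>{t0<..}\<close>; values of \<open>x\<close> outside of it are irrelevant.\<close>

definition hyperbolic_motion ::
    "('n::{finite,linorder} \<Rightarrow> real) \<Rightarrow> real \<Rightarrow> (real \<Rightarrow> 'e::euclidean_space ^ 'n::{finite,linorder}) \<Rightarrow> bool" where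
  "hyperbolic_motion m t0 x \<longleftrightarrow>
     newton_solution m {t0<..} x \<and>
     (\<exists>a. (\<forall>i. ((\<lambda>t. velocity x t $ i) \<longlongrightarrow> a $ i) at_top) \<and> (\<forall>i j. i \<noteq> j \<longrightarrow> a $ i \<noteq> a $ j))"

definition angular_momentum ::
    "('n::finite \<Rightarrow> real) \<Rightarrow> 'e::euclidean_space ^ 'n \<Rightarrow> 'e ^ 'n \<Rightarrow> 'e bivector" where
  "angular_momentum m x v = (\<Sum>i\<in>UNIV. m i *\<^sub>R (x $ i \<and>\<^sub>E v $ i))"

lemma collision_free_iff:
  fixes x :: "'e::euclidean_space ^ 'n::{finite,linorder}"
  assumes "\<And>i. m i > 0"
  shows "x \<in> collision_free m \<longleftrightarrow> (\<forall>i j. i \<noteq> j \<longrightarrow> x $ i \<noteq> x $ j)"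
proof -
  have summand: "ereal (m i * m j) * inverse (ereal (norm (x $ i - x $ j))) = \<infinity> \<longleftrightarrow> x $ i = x $ j"
    for i j
  proof (cases "x $ i = x $ j")
    case True
    have "m i * m j > 0" using assms by simp
    with True show ?thesis by auto
  next
    case False
    then show ?thesis by simp
  qed
  have "newton_potential m x = \<infinity> \<longleftrightarrow> (\<exists>i j. i < j \<and> x $ i = x $ j)"
    unfolding newton_potential_def sum_Pinfty using summand by auto
  then show ?thesis
    unfolding collision_free_def by (auto simp: less_top[symmetric]) (metis neq_iff)+
qed

end

theory Submission
  imports Defs
begin

text \<open>
  Far out, a motion with velocity close to \<open>a\<close> feels the force \<open>G(t a) = t\<^sup>-\<^sup>2 G(a)\<close>, where \<open>G\<close> is the
  Newtonian force field, homogeneous of degree \<open>-2\<close>. Integrating twice suggests the expansion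
  \<open>x(t) = t a - ln t G(a) + c + o(1)\<close> with a free constant configuration \<open>c\<close>. The angular momentum of such
  a motion is \<open>\<Sum>\<^sub>i m\<^sub>i c\<^sub>i \<and> a\<^sub>i\<close>: the two leading terms contribute nothing, because \<open>a \<and> a = 0\<close>
  and because the forces are central, which gives \<open>\<Sum>\<^sub>i m\<^sub>i a\<^sub>i \<and> G(a)\<^sub>i = 0\<close>. So the motion with \<open>c = 0\<close> is
  the one that is wanted.

  To construct it, put \<open>x(t) = t a - ln t G(a) + e(t)\<close>. Newton's equation together with \<open>e \<rightarrow> 0\<close>
  becomes the integral equation
  \<open>e(t) = \<integral>\<^sub>t\<^sup>\<infinity> (s - t) (G(x(s)) - s\<^sup>-\<^sup>2 G(a)) ds\<close>. By homogeneity the second factor is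
  \<open>s\<^sup>-\<^sup>2 (G(x(s)/s) - G(a))\<close>, and \<open>x(s)/s\<close> differs from \<open>a\<close> by \<open>O(ln s / s)\<close>. As \<open>G\<close> is
  Lipschitz near the collision-free configuration \<open>a\<close>, the integral converges, and its dependence on \<open>e\<close> has
  Lipschitz constant \<open>O(1/T)\<close> on \<open>[T, \<infinity>)\<close>. For large \<open>T\<close> the Banach fixed point theorem applies
  (\<open>inverse_square_asymptotic_solution\<close>). The same estimates give \<open>e \<rightarrow> 0\<close> and \<open>t e'(t) \<rightarrow> 0\<close>,
  so the angular momentum tends to \<open>0\<close>; being constant, it vanishes
  (\<open>moment_of_central_force_vanishes\<close>).
\<close>

section \<open>Tail integrals\<close>

lemma power_decay_integrable:
  fixes F :: "real \<Rightarrow> 'a::euclidean_space"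
  assumes cont: "continuous_on {T..} F" and T: "0 < T" and p: "p < -1"
    and bound: "\<And>s. s \<ge> T \<Longrightarrow> norm (F s) \<le> C * s powr p" and t: "t \<ge> T"
  shows "F integrable_on {t..}"
    and "norm (integral {t..} F) \<le> C * t powr (p + 1) / (- (p + 1))"
proof -
  have "((\<lambda>s. s powr p) has_integral - (t powr (p + 1)) / (p + 1)) {t..}"
    using has_integral_powr_to_inf[OF p, of t] T t by simp
  then have J: "((\<lambda>s. C * s powr p) has_integral C * (- (t powr (p + 1)) / (p + 1))) {t..}"
    by (rule has_integral_mult_right)
  have bound': "norm (F s) \<le> C * s powr p" if "s \<in> {t..}" for s
    using that t by (auto intro: bound)
  show int: "F integrable_on {t..}"
  proof (rule measurable_bounded_by_integrable_imp_integrable)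
    show "F \<in> borel_measurable (lebesgue_on {t..})"
      using t by (intro continuous_imp_measurable_on_sets_lebesgue continuous_on_subset[OF cont])
        auto
    show "(\<lambda>s. C * s powr p) integrable_on {t..}"
      using J by (rule has_integral_integrable)
  qed (use bound' in auto)
  have "norm (integral {t..} F) \<le> integral {t..} (\<lambda>s. C * s powr p)"
    by (rule integral_norm_bound_integral[OF int has_integral_integrable[OF J] bound'])
  also have "\<dots> = C * t powr (p + 1) / (- (p + 1))"
    unfolding integral_unique[OF J]
    by (simp only: minus_divide_right[symmetric] minus_divide_left[symmetric] times_divide_eq_right
        mult_minus_right)
  finally show "norm (integral {t..} F) \<le> C * t powr (p + 1) / (- (p + 1))" .
qed

lemma tail_integral_has_derivative:
  fixes F :: "real \<Rightarrow> 'a::euclidean_space"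
  assumes cont: "continuous_on {T..} F" and int: "\<And>t. t \<ge> T \<Longrightarrow> F integrable_on {t..}" and t: "t > T"
  shows "((\<lambda>t. integral {t..} F) has_vector_derivative - F t) (at t)"
proof -
  have split: "integral {u..} F = integral {T..} F - integral {T..u} F" if "u \<ge> T" for u
  proof -
    have "F integrable_on {T..u}"
      by (rule integrable_continuous_real, rule continuous_on_subset[OF cont]) simp
    moreover have "{T..u} \<inter> {u..} = {u}" using that by auto
    then have "negligible ({T..u} \<inter> {u..})" by simp
    ultimately have "integral ({T..u} \<union> {u..}) F = integral {T..u} F + integral {u..} F"
      by (rule integral_Un[OF _ int[OF that]])
    moreover have "{T..u} \<union> {u..} = {T..}" using that by auto
    ultimately show ?thesis by (metis add_diff_cancel_left')
  qed
  have "((\<lambda>u. integral {T..u} F) has_vector_derivative F t) (at t within {T..t+1})"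
    by (rule integral_has_vector_derivative, rule continuous_on_subset[OF cont]) (use t in simp_all)
  moreover have "at t within {T..t+1} = at t"
    by (rule at_within_interior) (use t in simp)
  ultimately have "((\<lambda>u. integral {T..u} F) has_vector_derivative F t) (at t)"
    by simp
  then have "((\<lambda>u. integral {T..} F - integral {T..u} F) has_vector_derivative 0 - F t) (at t)"
    by (intro has_vector_derivative_diff has_vector_derivative_const)
  then have "((\<lambda>u. integral {T..} F - integral {T..u} F) has_vector_derivative - F t) (at t)"
    by simp
  then show ?thesis
  proof (rule has_vector_derivative_transform_within_open[where S = "{T<..}"])
    show "integral {T..} F - integral {T..u} F = integral {u..} F" if "u \<in> {T<..}" for u
      using that by (intro split[symmetric]) auto
  qed (use t in auto)
qed

text \<open>
  By Cauchy's formula for repeated integration this is the second antiderivative of \<open>F\<close> that tends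
  to \<open>0\<close> at infinity.
\<close>

definition double_tail :: "(real \<Rightarrow> 'a::euclidean_space) \<Rightarrow> real \<Rightarrow> 'a" where
  "double_tail F t = integral {t..} (\<lambda>s. (s - t) *\<^sub>R F s)"

context
  fixes F :: "real \<Rightarrow> 'a::euclidean_space" and T C p :: real
  assumes cont: "continuous_on {T..} F" and T: "0 < T" and p: "p < -2"
    and bound: "\<And>s. s \<ge> T \<Longrightarrow> norm (F s) \<le> C * s powr p"
begin

lemma moment_bound:
  assumes "s \<ge> T" "0 \<le> r" "r \<le> s"
  shows "norm (r *\<^sub>R F s) \<le> C * s powr (p + 1)"
proof -
  have "norm (r *\<^sub>R F s) \<le> s * (C * s powr p)"
    using assms bound[of s] by (auto intro!: mult_mono)
  also have "\<dots> = C * s powr (p + 1)" using assms T by (simp add: powr_add)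
  finally show ?thesis .
qed

lemma double_tail_integrable:
  assumes "t \<ge> T"
  shows "F integrable_on {t..}" "(\<lambda>s. s *\<^sub>R F s) integrable_on {t..}"
    "(\<lambda>s. (s - t) *\<^sub>R F s) integrable_on {t..}"
proof -
  show 1: "F integrable_on {t..}"
    by (rule power_decay_integrable(1)[OF cont T _ bound assms]) (use p in auto)
  show 2: "(\<lambda>s. s *\<^sub>R F s) integrable_on {t..}"
  proof (rule power_decay_integrable(1)[OF _ T _ _ assms])
    show "continuous_on {T..} (\<lambda>s. s *\<^sub>R F s)"
      by (intro continuous_intros cont)
    show "norm (s *\<^sub>R F s) \<le> C * s powr (p + 1)" if "s \<ge> T" for s
      using that T by (intro moment_bound) auto
  qed (use p in simp)
  show "(\<lambda>s. (s - t) *\<^sub>R F s) integrable_on {t..}"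
    using integrable_diff[OF 2 integrable_cmul[OF 1, of t]] by (simp add: scaleR_diff_left)
qed

lemma norm_double_tail_le:
  assumes "t \<ge> T"
  shows "norm (double_tail F t) \<le> C * t powr (p + 2) / (- (p + 2))"
proof -
  have "norm (integral {t..} (\<lambda>s. (s - t) *\<^sub>R F s)) \<le> C * t powr (p + 1 + 1) / (- (p + 1 + 1))"
  proof (rule power_decay_integrable(2)[where T = t])
    show "continuous_on {t..} (\<lambda>s. (s - t) *\<^sub>R F s)"
      using assms by (intro continuous_intros continuous_on_subset[OF cont]) auto
    show "norm ((s - t) *\<^sub>R F s) \<le> C * s powr (p + 1)" if "s \<ge> t" for s
      using that assms T by (intro moment_bound) auto
  qed (use p T assms in auto)
  then show ?thesis by (simp add: double_tail_def add.assoc)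
qed

text \<open>
  Writing \<open>\<integral>\<^sub>t\<^sup>\<infinity> (s - t) F(s) ds\<close> as \<open>\<integral>\<^sub>t\<^sup>\<infinity> s F(s) ds - t \<integral>\<^sub>t\<^sup>\<infinity> F(s) ds\<close> moves \<open>t\<close> out
  of the integrands; on differentiating, the two boundary terms \<open>t F(t)\<close> cancel.
\<close>

lemma double_tail_has_derivative:
  assumes "t > T"
  shows "(double_tail F has_vector_derivative - integral {t..} F) (at t)"
proof -
  have "((\<lambda>t. integral {t..} F) has_vector_derivative - F t) (at t)"
    by (rule tail_integral_has_derivative[OF cont double_tail_integrable(1) assms])
  moreover have "((\<lambda>t. integral {t..} (\<lambda>s. s *\<^sub>R F s)) has_vector_derivative - (t *\<^sub>R F t)) (at t)"
  proof (rule tail_integral_has_derivative[OF _ _ assms])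
    show "continuous_on {T..} (\<lambda>s. s *\<^sub>R F s)"
      by (intro continuous_intros cont)
  qed (rule double_tail_integrable(2))
  ultimately have "((\<lambda>t. integral {t..} (\<lambda>s. s *\<^sub>R F s) - t *\<^sub>R integral {t..} F) has_vector_derivative
      - (t *\<^sub>R F t) - (t *\<^sub>R - F t + 1 *\<^sub>R integral {t..} F)) (at t)"
    by (intro has_vector_derivative_diff has_vector_derivative_scaleR DERIV_ident)
  then have *: "((\<lambda>t. integral {t..} (\<lambda>s. s *\<^sub>R F s) - t *\<^sub>R integral {t..} F) has_vector_derivative
      - integral {t..} F) (at t)"
    by simp
  have split: "double_tail F u = integral {u..} (\<lambda>s. s *\<^sub>R F s) - u *\<^sub>R integral {u..} F" if "u \<ge> T" for u
    using integral_diff[OF double_tail_integrable(2)[OF that] integrable_cmul[OF double_tail_integrable(1)[OF that], of u]]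
    by (simp add: double_tail_def scaleR_diff_left)
  show ?thesis
  proof (rule has_vector_derivative_transform_within_open[OF *, where S = "{T<..}"])
    show "integral {u..} (\<lambda>s. s *\<^sub>R F s) - u *\<^sub>R integral {u..} F = double_tail F u"
      if "u \<in> {T<..}" for u
      using that by (intro split[symmetric]) auto
  qed (use assms in auto)
qed

end
section \<open>Solutions with prescribed logarithmic asymptotics\<close>

lemma ln_le_two_sqrt:
  fixes s :: real
  assumes "s > 0"
  shows "ln s \<le> 2 * sqrt s"
  using ln_le_minus_one[of "sqrt s"] ln_sqrt[of s] assms by simp

text \<open>
  Existence of an escaping solution for any force field that is homogeneous of degree \<open>-2\<close> and
  Lipschitz near the direction of escape. Here \<open>e\<close> is the remainder of the position and \<open>f\<close> that of
  the velocity. The rate \<open>f(t) = o(1/t)\<close> is what the angular momentum needs, since there \<open>f\<close> is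
  multiplied by a position of size \<open>t\<close>.
\<close>

lemma inverse_square_asymptotic_solution:
  fixes G :: "'a::euclidean_space \<Rightarrow> 'a"
  assumes hom: "\<And>s y. s > 0 \<Longrightarrow> G (s *\<^sub>R y) = inverse (s\<^sup>2) *\<^sub>R G y"
    and lip: "L-lipschitz_on (cball a \<delta>) G" and \<delta>: "\<delta> > 0"
  obtains T e f where "T > 0"
    and "\<And>t. t > T \<Longrightarrow> (1 / t) *\<^sub>R (t *\<^sub>R a - ln t *\<^sub>R G a + e t) \<in> cball a \<delta>"
    and "\<And>t. t > T \<Longrightarrow> (e has_vector_derivative f t) (at t)"
    and "\<And>t. t > T \<Longrightarrow>
      (f has_vector_derivative G (t *\<^sub>R a - ln t *\<^sub>R G a + e t) - inverse (t\<^sup>2) *\<^sub>R G a) (at t)"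
    and "(e \<longlongrightarrow> 0) at_top" and "((\<lambda>t. t *\<^sub>R f t) \<longlongrightarrow> 0) at_top"
proof -
  define g where "g = G a"
  \<comment> \<open>For \<open>s \<ge> 1\<close> and a remainder of norm at most \<open>1\<close>, the deviation \<open>e - ln s g\<close> from free motion
    has norm at most \<open>K \<surd>s\<close>. The square root, in place of the logarithm, keeps all bounds powers of \<open>s\<close>.\<close>
  define K where "K = 2 * norm g + 1"
  \<comment> \<open>The rescaled position \<open>x(s)/s\<close>, and the excess \<open>G(x(s)) - s\<^sup>-\<^sup>2 g\<close> of the force as homogeneity
    rewrites it, as functions of the value \<open>e\<close> of the remainder at time \<open>s\<close>.\<close>
  define Y where "Y = (\<lambda>s e. a + (1 / s) *\<^sub>R (e - ln s *\<^sub>R g))"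
  define R where "R = (\<lambda>s e. inverse (s\<^sup>2) *\<^sub>R (G (Y s e) - g))"
  have L: "L \<ge> 0" by (rule lipschitz_on_nonneg[OF lip])
  have K: "K \<ge> 1" by (simp add: K_def)
  \<comment> \<open>The three smallness conditions say, in this order, that the rescaled position stays in the ball on
    which \<open>G\<close> is Lipschitz, that the integral operator preserves the unit ball, and that it contracts
    by the factor \<open>1/2\<close>.\<close>
  obtain T where T: "T \<ge> 1" "K * T powr (-1/2) \<le> \<delta>" "2 * (L * K) * T powr (-1/2) \<le> 1"
    "L * T powr (-1) \<le> 1/2"
  proof -
    have lim: "((\<lambda>T::real. c * T powr p) \<longlongrightarrow> 0) at_top" if "p < 0" for c p
      by (intro tendsto_mult_right_zero tendsto_neg_powr that filterlim_ident)
    have "\<forall>\<^sub>F T in at_top. (T::real) \<ge> 1 \<and> K * T powr (-1/2) < \<delta> \<and>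
        2 * (L * K) * T powr (-1/2) < 1 \<and> L * T powr (-1) < 1/2"
      using \<delta> by (intro eventually_conj eventually_ge_at_top order_tendstoD(2)[OF lim]) auto
    then obtain T :: real where "T \<ge> 1 \<and> K * T powr (-1/2) < \<delta> \<and>
        2 * (L * K) * T powr (-1/2) < 1 \<and> L * T powr (-1) < 1/2"
      using eventually_happens'[OF trivial_limit_at_top_linorder] by blast
    then show ?thesis by (intro that) auto
  qed

  have Y_near: "norm (Y s e - a) \<le> K * s powr (-1/2)" if s: "s \<ge> T" and e: "norm e \<le> 1" for s e
  proof -
    have s1: "s \<ge> 1" using s T by simp
    have "norm (e - ln s *\<^sub>R g) \<le> norm e + ln s * norm g"
      using norm_triangle_ineq4[of e "ln s *\<^sub>R g"] s1 by simp
    also have "\<dots> \<le> sqrt s + 2 * sqrt s * norm g"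
    proof (intro add_mono mult_right_mono)
      have "1 \<le> sqrt s" using s1 by simp
      then show "norm e \<le> sqrt s" using e by linarith
    qed (use s1 ln_le_two_sqrt[of s] in auto)
    also have "\<dots> = K * sqrt s" by (simp add: K_def algebra_simps)
    finally have "(1 / s) * norm (e - ln s *\<^sub>R g) \<le> (1 / s) * (K * sqrt s)"
      using s1 by (intro mult_left_mono) auto
    also have "(1 / s) * (K * sqrt s) = K * s powr (-1/2)"
    proof -
      have "sqrt s = s powr (1 + -1/2)" using s1 by (simp add: powr_half_sqrt)
      also have "\<dots> = s * s powr (-1/2)" using s1 unfolding powr_add by simp
      finally show ?thesis using s1 by simp
    qed
    finally show ?thesis using s1 by (simp add: Y_def)
  qed
  have Y_in: "Y s e \<in> cball a \<delta>" if s: "s \<ge> T" and e: "norm e \<le> 1" for s e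
  proof -
    have "K * s powr (-1/2) \<le> K * T powr (-1/2)"
      using K T s by (intro mult_left_mono powr_mono2') auto
    then have "norm (Y s e - a) \<le> \<delta>" using Y_near[OF s e] T by linarith
    then show ?thesis by (simp add: dist_norm norm_minus_commute)
  qed
  have a_in: "a \<in> cball a \<delta>" using \<delta> by simp
  have inv_sq: "inverse (s\<^sup>2) = s powr (-2)" if "s \<ge> T" for s
    using that T by (simp add: powr_minus)
  have R_bound: "norm (R s e) \<le> (L * K) * s powr (-5/2)" if s: "s \<ge> T" and e: "norm e \<le> 1" for s e
  proof -
    have "norm (G (Y s e) - g) \<le> L * norm (Y s e - a)"
      unfolding g_def by (rule lipschitz_on_normD[OF lip Y_in[OF s e] a_in])
    also have "\<dots> \<le> L * (K * s powr (-1/2))" by (rule mult_left_mono[OF Y_near[OF s e] L])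
    finally have "norm (R s e) \<le> s powr (-2) * (L * (K * s powr (-1/2)))"
      unfolding R_def inv_sq[OF s] by (simp add: mult_left_mono)
    also have "\<dots> = (L * K) * (s powr (-2) * s powr (-1/2))" by simp
    also have "s powr (-2) * s powr (-1/2) = s powr (-5/2)" by (simp flip: powr_add)
    finally show ?thesis .
  qed
  have R_lip: "norm (R s e - R s e') \<le> (L * norm (e - e')) * s powr (-3)"
    if s: "s \<ge> T" and e: "norm e \<le> 1" "norm e' \<le> 1" for s e e'
  proof -
    have *: "norm (G (Y s e) - G (Y s e')) \<le> L * norm (Y s e - Y s e')"
      by (rule lipschitz_on_normD[OF lip Y_in[OF s e(1)] Y_in[OF s e(2)]])
    have "Y s e - Y s e' = (1 / s) *\<^sub>R (e - e')" by (simp add: Y_def algebra_simps)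
    moreover have "s powr (-1) = 1 / s" using s T by (simp add: powr_minus_divide)
    ultimately have Y_diff: "norm (Y s e - Y s e') = s powr (-1) * norm (e - e')"
      using s T by simp
    have "norm (R s e - R s e') = s powr (-2) * norm (G (Y s e) - G (Y s e'))"
      by (simp add: R_def inv_sq[OF s] flip: scaleR_diff_right)
    also have "\<dots> \<le> s powr (-2) * (L * (s powr (-1) * norm (e - e')))"
      using * unfolding Y_diff by (rule mult_left_mono) simp
    also have "\<dots> = (L * norm (e - e')) * (s powr (-2) * s powr (-1))" by simp
    also have "s powr (-2) * s powr (-1) = s powr (-3)"
      unfolding powr_add[symmetric] by simp
    finally show ?thesis .
  qed
  have R_cont: "continuous_on {T..} (\<lambda>s. R s (u s))"
    if "continuous_on {T..} u" and "\<And>s. norm (u s) \<le> 1" for u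
  proof -
    have "continuous_on {T..} (\<lambda>s. Y s (u s))"
      unfolding Y_def using T by (intro continuous_intros that) auto
    then have "continuous_on {T..} (\<lambda>s. G (Y s (u s)))"
      by (rule continuous_on_compose2[OF lipschitz_on_continuous_on[OF lip]])
        (use Y_in that in auto)
    then show ?thesis
      unfolding R_def using T by (intro continuous_intros) auto
  qed

  \<comment> \<open>The integral operator acts on bounded continuous functions on the whole line. Its values are frozen
    for \<open>t \<le> T + 1\<close>; the margin above \<open>T\<close> leaves room for two-sided derivatives of the tail integrals,
    which are controlled from \<open>T\<close> on.\<close>
  define \<Phi> where "\<Phi> = (\<lambda>(u :: real \<Rightarrow>\<^sub>C 'a) t. double_tail (\<lambda>s. R s (u s)) (max t (T + 1)))"
  define B where "B = (cball 0 1 :: (real \<Rightarrow>\<^sub>C 'a) set)"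
  have u_le: "norm (u s) \<le> 1" if "u \<in> B" for u s
    using that norm_bounded[of u s] by (simp add: B_def)
  have T0: "0 < T" using T by simp
  have tail_bound: "norm (double_tail (\<lambda>s. R s (u s)) t) \<le> 2 * (L * K) * t powr (-1/2)"
    if "u \<in> B" "t \<ge> T" for u t
    using norm_double_tail_le[where F = "\<lambda>s. R s (u s)" and p = "-5/2", OF R_cont T0 _ R_bound, of t] u_le[OF that(1)] that(2)
    by simp
  have tail_deriv: "(double_tail (\<lambda>s. R s (u s)) has_vector_derivative - integral {t..} (\<lambda>s. R s (u s))) (at t)"
    if "u \<in> B" "t > T" for u t
    by (rule double_tail_has_derivative[where p = "-5/2", OF R_cont T0 _ R_bound])
      (use that u_le in auto)
  have \<Phi>_le: "norm (\<Phi> u t) \<le> 1" if "u \<in> B" for u t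
  proof -
    have "norm (\<Phi> u t) \<le> 2 * (L * K) * max t (T + 1) powr (-1/2)"
      unfolding \<Phi>_def by (rule tail_bound[OF that]) simp
    also have "\<dots> \<le> 2 * (L * K) * T powr (-1/2)"
      using T L K by (intro mult_left_mono powr_mono2') auto
    finally show ?thesis using T by simp
  qed
  have \<Phi>_cont: "continuous_on UNIV (\<Phi> u)" if "u \<in> B" for u
  proof -
    have "continuous_on {T<..} (double_tail (\<lambda>s. R s (u s)))"
      using tail_deriv[OF that]
      by (intro continuous_at_imp_continuous_on ballI) (auto intro: has_vector_derivative_continuous)
    then show ?thesis
      unfolding \<Phi>_def by (rule continuous_on_compose2) (auto intro!: continuous_intros)
  qed
  define P where "P u = Bcontfun (\<Phi> u)" for u
  have P: "apply_bcontfun (P u) = \<Phi> u" if "u \<in> B" for u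
    unfolding P_def by (rule Bcontfun_inverse[OF bcontfun_normI[OF \<Phi>_cont \<Phi>_le]]) (use that in auto)
  have "\<exists>!u\<in>B. P u = u"
  proof (rule Banach_fix)
    show "complete B" unfolding B_def by (simp add: complete_eq_closed)
    show "B \<noteq> {}" by (simp add: B_def)
    show "P ` B \<subseteq> B"
    proof safe
      fix u assume "u \<in> B"
      then have "norm (P u) \<le> 1" by (intro norm_bound) (simp add: P \<Phi>_le)
      then show "P u \<in> B" by (simp add: B_def)
    qed
    show "dist (P u) (P v) \<le> 1/2 * dist u v" if u: "u \<in> B" and v: "v \<in> B" for u v
    proof (rule dist_bound)
      fix t
      define \<tau> where "\<tau> = max t (T + 1)"
      have \<tau>: "\<tau> \<ge> T" by (simp add: \<tau>_def)
      define D where "D s = R s (u s) - R s (v s)" for s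
      have D: "norm (D s) \<le> (L * dist u v) * s powr (-3)" if s: "s \<ge> T" for s
      proof -
        have "norm (D s) \<le> (L * norm (u s - v s)) * s powr (-3)"
          unfolding D_def by (rule R_lip[OF s u_le[OF u] u_le[OF v]])
        also have "\<dots> \<le> (L * dist u v) * s powr (-3)"
          using dist_bounded[of u s v] L by (intro mult_right_mono mult_left_mono) (auto simp: dist_norm)
        finally show ?thesis .
      qed
      have D_cont: "continuous_on {T..} D"
        unfolding D_def using u_le u v by (intro continuous_on_diff R_cont) auto
      have int: "(\<lambda>s. (s - \<tau>) *\<^sub>R R s (w s)) integrable_on {\<tau>..}" if "w \<in> B" for w
        by (rule double_tail_integrable(3)[where p = "-5/2", OF R_cont T0 _ R_bound])
          (use \<tau> that u_le in auto)
      have "\<Phi> u t - \<Phi> v t = double_tail D \<tau>"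
        using integral_diff[OF int[OF u] int[OF v]]
        by (simp add: \<Phi>_def double_tail_def D_def \<tau>_def scaleR_diff_right)
      then have "norm (\<Phi> u t - \<Phi> v t) \<le> (L * dist u v) * \<tau> powr (-1)"
        using norm_double_tail_le[OF D_cont T0 _ D \<tau>] by simp
      also have "\<dots> \<le> (L * dist u v) * T powr (-1)"
        using T L \<tau> by (intro mult_left_mono powr_mono2') auto
      also have "\<dots> = (L * T powr (-1)) * dist u v" by simp
      also have "\<dots> \<le> 1/2 * dist u v" using T by (intro mult_right_mono) auto
      finally show "dist (P u t) (P v t) \<le> 1/2 * dist u v"
        by (simp add: P u v dist_norm)
    qed
  qed auto
  then obtain u where u: "u \<in> B" "P u = u" by blast

  define e where "e = double_tail (\<lambda>s. R s (u s))"
  define f where "f t = - integral {t..} (\<lambda>s. R s (u s))" for t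
  have u_eq: "u t = e t" if "t > T + 1" for t
    using fun_cong[OF P[OF u(1), unfolded u(2)], of t] that by (simp add: \<Phi>_def e_def max_def)
  have position: "t *\<^sub>R Y t (e t) = t *\<^sub>R a - ln t *\<^sub>R G a + e t" if "t > T + 1" for t
    using that T by (simp add: Y_def g_def algebra_simps)
  show thesis
  proof
    show "T + 1 > 0" using T by simp
    show "(1 / t) *\<^sub>R (t *\<^sub>R a - ln t *\<^sub>R G a + e t) \<in> cball a \<delta>" if t: "t > T + 1" for t
      using Y_in[of t "e t"] u_le[OF u(1), of t] u_eq[OF t] t T by (simp flip: position)
    show "(e has_vector_derivative f t) (at t)" if "t > T + 1" for t
      unfolding e_def f_def by (rule tail_deriv[OF u(1)]) (use that in simp)
    show "(f has_vector_derivative G (t *\<^sub>R a - ln t *\<^sub>R G a + e t) - inverse (t\<^sup>2) *\<^sub>R G a) (at t)"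
      if t: "t > T + 1" for t
    proof -
      have cont: "continuous_on {T..} (\<lambda>s. R s (u s))"
        by (rule R_cont) (use u_le[OF u(1)] in auto)
      have "((\<lambda>t. integral {t..} (\<lambda>s. R s (u s))) has_vector_derivative - R t (u t)) (at t)"
        by (rule tail_integral_has_derivative[OF cont double_tail_integrable(1)[where p = "-5/2", OF cont T0 _ R_bound]])
          (use t u_le[OF u(1)] in auto)
      then have "(f has_vector_derivative - (- R t (u t))) (at t)"
        unfolding f_def by (rule has_vector_derivative_minus)
      moreover have "R t (u t) = G (t *\<^sub>R a - ln t *\<^sub>R G a + e t) - inverse (t\<^sup>2) *\<^sub>R G a"
        using t T hom[of t "Y t (e t)"] by (simp add: R_def u_eq g_def scaleR_diff_right flip: position)
      ultimately show ?thesis by simp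
    qed
    show "(e \<longlongrightarrow> 0) at_top"
    proof (rule Lim_null_comparison)
      show "\<forall>\<^sub>F t in at_top. norm (e t) \<le> 2 * (L * K) * t powr (-1/2)"
        using eventually_ge_at_top[of T] unfolding e_def
        by eventually_elim (rule tail_bound[OF u(1)])
      show "((\<lambda>t. 2 * (L * K) * t powr (-1/2)) \<longlongrightarrow> 0) at_top"
        by (intro tendsto_mult_right_zero tendsto_neg_powr filterlim_ident) simp
    qed
    show "((\<lambda>t. t *\<^sub>R f t) \<longlongrightarrow> 0) at_top"
    proof (rule Lim_null_comparison)
      show "\<forall>\<^sub>F t in at_top. norm (t *\<^sub>R f t) \<le> (2/3 * (L * K)) * t powr (-1/2)"
        using eventually_ge_at_top[of T]
      proof eventually_elim
        fix t assume t: "t \<ge> T"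
        have "norm (f t) \<le> (L * K) * t powr (-5/2 + 1) / (- (-5/2 + 1))"
          unfolding f_def norm_minus_cancel
          by (rule power_decay_integrable(2)[OF R_cont T0 _ R_bound]) (use t u_le[OF u(1)] in auto)
        then have "t * norm (f t) \<le> t * ((2/3 * (L * K)) * t powr (-3/2))"
          using t T by (intro mult_left_mono) (auto simp: field_simps)
        also have "\<dots> = (2/3 * (L * K)) * (t powr 1 * t powr (-3/2))" using t T by simp
        also have "t powr 1 * t powr (-3/2) = t powr (-1/2)"
          unfolding powr_add[symmetric] by simp
        finally show "norm (t *\<^sub>R f t) \<le> (2/3 * (L * K)) * t powr (-1/2)" using t T by simp
      qed
      show "((\<lambda>t. (2/3 * (L * K)) * t powr (-1/2)) \<longlongrightarrow> 0) at_top"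
        by (intro tendsto_mult_right_zero tendsto_neg_powr filterlim_ident) simp
    qed
  qed
qed

section \<open>The Newtonian force field\<close>

text \<open>The inverse-square attraction \<open>v / |v|\<^sup>3\<close>, with value \<open>0\<close> at \<open>v = 0\<close>.\<close>

definition coulomb :: "'e::real_inner \<Rightarrow> 'e" where
  "coulomb v = inverse (norm v ^ 3) *\<^sub>R v"

lemma coulomb_minus: "coulomb (- v) = - coulomb v"
  by (simp add: coulomb_def)

lemma coulomb_scaleR:
  assumes "s > 0"
  shows "coulomb (s *\<^sub>R v) = inverse (s\<^sup>2) *\<^sub>R coulomb v"
  using assms by (simp add: coulomb_def power_mult_distrib power2_eq_square power3_eq_cube)

text \<open>
  With \<open>p = |v|\<close> and \<open>q = |w|\<close>, split \<open>v/p\<^sup>3 - w/q\<^sup>3\<close> as \<open>(v - w)/p\<^sup>3 + (1/p\<^sup>3 - 1/q\<^sup>3) w\<close>. The second term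
  has norm \<open>|q - p| (1/p\<^sup>3 + 1/(p\<^sup>2 q) + 1/(p q\<^sup>2))\<close>, so the four reciprocal cubes, each at most \<open>1/c\<^sup>3\<close>,
  make up the constant.
\<close>

lemma coulomb_lipschitz:
  assumes c: "c > 0"
  shows "(4 / c ^ 3)-lipschitz_on {v :: 'e::real_inner. c \<le> norm v} coulomb"
proof (rule lipschitz_onI)
  fix v w :: 'e
  assume "v \<in> {v. c \<le> norm v}" "w \<in> {v. c \<le> norm v}"
  then have vw: "c \<le> norm v" "c \<le> norm w" by auto
  define p where "p = norm v"
  define q where "q = norm w"
  have pos: "p > 0" "q > 0" "c \<le> p" "c \<le> q" using vw c by (auto simp: p_def q_def)
  have pq: "\<bar>q - p\<bar> \<le> norm (v - w)" unfolding p_def q_def by (metis abs_minus_commute norm_triangle_ineq3)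
  have inv: "inverse (p ^ i * q ^ j) \<le> 1 / c ^ 3" if "i + j = 3" for i j
  proof -
    have "c ^ i * c ^ j \<le> p ^ i * q ^ j" using pos c by (intro mult_mono power_mono) auto
    then have "c ^ 3 \<le> p ^ i * q ^ j" by (simp flip: power_add that)
    then have "inverse (p ^ i * q ^ j) \<le> inverse (c ^ 3)" by (rule le_imp_inverse_le) (use c in simp)
    then show ?thesis by (simp add: inverse_eq_divide)
  qed
  have "\<bar>inverse (p ^ 3) - inverse (q ^ 3)\<bar> * q = \<bar>(inverse (p ^ 3) - inverse (q ^ 3)) * q\<bar>"
    using pos by (simp add: abs_mult)
  also have "(inverse (p ^ 3) - inverse (q ^ 3)) * q =
      (q - p) * (inverse (p ^ 3 * q ^ 0) + inverse (p ^ 2 * q ^ 1) + inverse (p ^ 1 * q ^ 2))"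
  proof -
    have "inverse p * p = 1" "inverse q * q = 1" using pos by auto
    then have "(inverse p ^ 3 - inverse q ^ 3) * q =
        (q - p) * (inverse p ^ 3 + inverse p ^ 2 * inverse q + inverse p * inverse q ^ 2)"
      by algebra
    then show ?thesis by (simp add: power_inverse)
  qed
  also have "\<bar>\<dots>\<bar> = \<bar>q - p\<bar> * (inverse (p ^ 3 * q ^ 0) + inverse (p ^ 2 * q ^ 1) + inverse (p ^ 1 * q ^ 2))"
    using pos by (simp add: abs_mult)
  also have "\<dots> \<le> norm (v - w) * (1 / c ^ 3 + 1 / c ^ 3 + 1 / c ^ 3)"
    using pq pos by (intro mult_mono add_mono inv) auto
  finally have A: "\<bar>inverse (p ^ 3) - inverse (q ^ 3)\<bar> * q \<le> norm (v - w) * (3 / c ^ 3)" by simp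
  have "coulomb v - coulomb w = inverse (p ^ 3) *\<^sub>R (v - w) + (inverse (p ^ 3) - inverse (q ^ 3)) *\<^sub>R w"
    by (simp add: coulomb_def p_def q_def algebra_simps)
  then have "norm (coulomb v - coulomb w) \<le>
      inverse (p ^ 3) * norm (v - w) + \<bar>inverse (p ^ 3) - inverse (q ^ 3)\<bar> * q"
    using norm_triangle_ineq[of "inverse (p ^ 3) *\<^sub>R (v - w)" "(inverse (p ^ 3) - inverse (q ^ 3)) *\<^sub>R w"] pos
    by (simp add: q_def)
  also have "\<dots> \<le> (1 / c ^ 3) * norm (v - w) + norm (v - w) * (3 / c ^ 3)"
    using inv[of 3 0] A by (intro add_mono mult_right_mono) auto
  also have "\<dots> = 4 / c ^ 3 * norm (v - w)" by (simp add: field_simps)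
  finally show "dist (coulomb v) (coulomb w) \<le> 4 / c ^ 3 * dist v w" by (simp add: dist_norm)
qed (use c in simp)

text \<open>
  The summand \<open>j = i\<close> is \<open>coulomb 0 = 0\<close>, so the sum may run over all bodies.
\<close>

definition newton_field :: "('n::finite \<Rightarrow> real) \<Rightarrow> 'e::euclidean_space ^ 'n \<Rightarrow> 'e ^ 'n" where
  "newton_field m x = (\<chi> i. \<Sum>j\<in>UNIV. m j *\<^sub>R coulomb (x $ j - x $ i))"

lemma newton_field_scaleR:
  assumes "s > 0"
  shows "newton_field m (s *\<^sub>R x) = inverse (s\<^sup>2) *\<^sub>R newton_field m x"
  by (simp add: newton_field_def vec_eq_iff scaleR_sum_right coulomb_scaleR[OF assms] mult.commute
      flip: scaleR_diff_right)

text \<open>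
  If the bodies of \<open>a\<close> are at mutual distance at least \<open>2c\<close>, then within distance \<open>c/2\<close> of \<open>a\<close> they stay
  \<open>c\<close> apart, where the pair forces are Lipschitz.
\<close>

lemma newton_field_locally_lipschitz:
  fixes a :: "'e::euclidean_space ^ 'n::{finite,linorder}"
  assumes m: "\<And>i. m i > 0" and a: "a \<in> collision_free m"
  obtains \<delta> L where "\<delta> > 0" and "cball a \<delta> \<subseteq> collision_free m"
    and "L-lipschitz_on (cball a \<delta>) (newton_field m)"
proof -
  \<comment> \<open>The element \<open>1\<close> makes \<open>S\<close> nonempty when there is only one body.\<close>
  define S where "S = insert 1 {norm (a $ i - a $ j) |i j. i \<noteq> j}"
  have "{norm (a $ i - a $ j) |i j. i \<noteq> j} \<subseteq> (\<lambda>(i, j). norm (a $ i - a $ j)) ` UNIV" by auto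
  then have "finite {norm (a $ i - a $ j) |i j. i \<noteq> j}" by (rule finite_subset) simp
  then have S: "finite S" unfolding S_def by simp
  define c where "c = Min S / 2"
  have "\<forall>r\<in>S. r > 0" using a by (auto simp: S_def collision_free_iff[OF m])
  then have c: "c > 0" unfolding c_def using S by (subst zero_less_divide_iff) (auto simp: S_def)
  have sep: "2 * c \<le> norm (a $ i - a $ j)" if "i \<noteq> j" for i j
    unfolding c_def using S that by (auto simp: S_def intro!: Min_le)
  have sep': "c \<le> norm (y $ i - y $ j)" if y: "y \<in> cball a (c / 2)" and ij: "i \<noteq> j" for y i j
  proof -
    have "norm ((a - y) $ k) \<le> c / 2" for k
      using y Finite_Cartesian_Product.norm_nth_le[of "a - y" k] by (simp add: dist_norm)
    then have "norm ((a - y) $ i - (a - y) $ j) \<le> c"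
      using norm_triangle_ineq4[of "(a - y) $ i" "(a - y) $ j"] by (smt (verit) field_sum_of_halves)
    moreover have "(a - y) $ i - (a - y) $ j = (a $ i - a $ j) - (y $ i - y $ j)" by simp
    ultimately have "norm ((a $ i - a $ j) - (y $ i - y $ j)) \<le> c" by metis
    then show ?thesis
      using sep[OF ij] norm_triangle_ineq2[of "a $ i - a $ j" "y $ i - y $ j"] by linarith
  qed
  define L where "L = (\<Sum>i::'n\<in>UNIV. \<Sum>j\<in>UNIV. m j * (8 / c ^ 3))"
  show thesis
  proof
    show "c / 2 > 0" using c by simp
    show "cball a (c / 2) \<subseteq> collision_free m"
      using sep' c unfolding collision_free_iff[OF m] subset_iff by fastforce
    show "L-lipschitz_on (cball a (c / 2)) (newton_field m)"
    proof (rule lipschitz_onI)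
      show "L \<ge> 0" unfolding L_def using m c by (intro sum_nonneg) (auto simp: less_imp_le)
      fix y z assume y: "y \<in> cball a (c / 2)" and z: "z \<in> cball a (c / 2)"
      have pair: "norm (coulomb (y $ j - y $ i) - coulomb (z $ j - z $ i)) \<le> 8 / c ^ 3 * norm (y - z)" for i j
      proof (cases "i = j")
        case True
        then show ?thesis using c by simp
      next
        case False
        have "norm ((y $ j - y $ i) - (z $ j - z $ i)) \<le> 2 * norm (y - z)"
          using norm_triangle_ineq4[of "(y - z) $ j" "(y - z) $ i"] Finite_Cartesian_Product.norm_nth_le[of "y - z" i]
            Finite_Cartesian_Product.norm_nth_le[of "y - z" j] by (simp add: algebra_simps)
        then have "4 / c ^ 3 * norm ((y $ j - y $ i) - (z $ j - z $ i)) \<le> 4 / c ^ 3 * (2 * norm (y - z))"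
          using c by (intro mult_left_mono) auto
        moreover have "norm (coulomb (y $ j - y $ i) - coulomb (z $ j - z $ i))
            \<le> 4 / c ^ 3 * norm ((y $ j - y $ i) - (z $ j - z $ i))"
          by (rule lipschitz_on_normD[OF coulomb_lipschitz[OF c]]) (use sep' y z False in auto)
        ultimately show ?thesis by simp
      qed
      have "norm (newton_field m y - newton_field m z)
          \<le> (\<Sum>i\<in>UNIV. norm ((newton_field m y - newton_field m z) $ i))"
        unfolding norm_vec_def by (rule L2_set_le_sum) simp
      also have "\<dots> \<le> (\<Sum>i::'n\<in>UNIV. \<Sum>j\<in>UNIV. m j * (8 / c ^ 3 * norm (y - z)))"
      proof (rule sum_mono)
        fix i :: 'n
        have "(newton_field m y - newton_field m z) $ i =
            (\<Sum>j\<in>UNIV. m j *\<^sub>R (coulomb (y $ j - y $ i) - coulomb (z $ j - z $ i)))"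
          by (simp add: newton_field_def sum_subtractf scaleR_diff_right)
        moreover have "norm (\<Sum>j\<in>UNIV. m j *\<^sub>R (coulomb (y $ j - y $ i) - coulomb (z $ j - z $ i)))
            \<le> (\<Sum>j\<in>UNIV. m j * (8 / c ^ 3 * norm (y - z)))"
        proof (rule sum_norm_le)
          fix j
          show "norm (m j *\<^sub>R (coulomb (y $ j - y $ i) - coulomb (z $ j - z $ i)))
              \<le> m j * (8 / c ^ 3 * norm (y - z))"
            using mult_left_mono[OF pair[of j i]] m[of j] by simp
        qed
        ultimately show "norm ((newton_field m y - newton_field m z) $ i)
            \<le> (\<Sum>j\<in>UNIV. m j * (8 / c ^ 3 * norm (y - z)))" by simp
      qed
      also have "\<dots> = L * norm (y - z)"
        by (simp add: L_def sum_distrib_right mult.assoc)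
      finally show "dist (newton_field m y) (newton_field m z) \<le> L * dist y z"
        by (simp add: dist_norm)
    qed
  qed
qed

lemma open_collision_free:
  assumes m: "\<And>i. m i > 0"
  shows "open (collision_free m :: ('e::euclidean_space ^ 'n::{finite,linorder}) set)"
proof -
  have "(collision_free m :: ('e ^ 'n::{finite,linorder}) set) =
      (\<Inter>i. \<Inter>j\<in>{j. i \<noteq> j}. {x. x $ i \<noteq> x $ j})"
    by (auto simp: collision_free_iff[OF m])
  also have "open \<dots>"
    by (intro open_INT ballI open_Collect_neq continuous_intros) auto
  finally show ?thesis .
qed

lemma newton_potential_collision_free:
  fixes x :: "'e::euclidean_space ^ 'n::{finite,linorder}"
  assumes m: "\<And>i. m i > 0" and x: "x \<in> collision_free m"
  shows "real_of_ereal (newton_potential m x) =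
    (\<Sum>(i, j)\<in>{(i, j). i < j}. m i * m j * inverse (norm (x $ i - x $ j)))"
proof -
  have "newton_potential m x =
      (\<Sum>(i, j)\<in>{(i, j). i < j}. ereal (m i * m j * inverse (norm (x $ i - x $ j))))"
    unfolding newton_potential_def
    using x by (intro sum.cong) (auto simp: collision_free_iff[OF m])
  then show ?thesis by (simp add: case_prod_unfold)
qed

lemma sum_ordered_pairs:
  fixes f :: "'n::{finite,linorder} \<Rightarrow> 'n \<Rightarrow> 'b::comm_monoid_add"
  assumes diag: "\<And>i. f i i = 0"
  shows "(\<Sum>(i, j)\<in>{(i, j). i < j}. f i j + f j i) = (\<Sum>i\<in>UNIV. \<Sum>j\<in>UNIV. f i j)"
proof -
  let ?lt = "{(i, j). i < j} :: ('n \<times> 'n) set" and ?gt = "{(i, j). j < i} :: ('n \<times> 'n) set"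
  have "(\<Sum>i\<in>UNIV. \<Sum>j\<in>UNIV. f i j) = (\<Sum>(i, j)\<in>UNIV. f i j)"
    by (simp add: sum.cartesian_product)
  also have "\<dots> = (\<Sum>(i, j)\<in>?lt \<union> ?gt. f i j)"
  proof (rule sum.mono_neutral_right)
    show "\<forall>z\<in>UNIV - (?lt \<union> ?gt). (case z of (i, j) \<Rightarrow> f i j) = 0"
      using diag by (auto simp: not_less_iff_gr_or_eq)
  qed auto
  also have "\<dots> = (\<Sum>(i, j)\<in>?lt. f i j) + (\<Sum>(i, j)\<in>?gt. f i j)"
    by (rule sum.union_disjoint) auto
  also have "(\<Sum>(i, j)\<in>?gt. f i j) = (\<Sum>(i, j)\<in>?lt. f j i)"
    by (rule sum.reindex_bij_witness[of _ prod.swap prod.swap]) auto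
  also have "(\<Sum>(i, j)\<in>?lt. f i j) + (\<Sum>(i, j)\<in>?lt. f j i) = (\<Sum>(i, j)\<in>?lt. f i j + f j i)"
    unfolding case_prod_unfold by (rule sum.distrib[symmetric])
  finally show ?thesis by (rule sym)
qed

text \<open>
  The derivative of the potential is a sum over pairs \<open>i < j\<close>, in which each pair contributes one
  force on \<open>i\<close> and the opposite force on \<open>j\<close>. Regrouping by bodies gives the force field weighted by
  the masses.
\<close>

lemma newton_field_is_mass_gradient:
  fixes x :: "'e::euclidean_space ^ 'n::{finite,linorder}"
  assumes m: "\<And>i. m i > 0" and x: "x \<in> collision_free m"
  shows "has_mass_gradient m (\<lambda>y. real_of_ereal (newton_potential m y)) (newton_field m x) x"
proof -
  \<comment> \<open>The work on \<open>i\<close>, under the displacement \<open>h\<close>, of the attraction by \<open>j\<close>.\<close>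
  define f where "f h i j = m i * m j * (coulomb (x $ j - x $ i) \<bullet> (h $ i))" for h :: "'e ^ 'n::{finite,linorder}" and i j
  have pair: "((\<lambda>y. m i * m j * inverse (norm (y $ i - y $ j))) has_derivative (\<lambda>h. f h i j + f h j i)) (at x)"
    if "i < j" for i j
  proof -
    define d where "d = x $ i - x $ j"
    have d: "d \<noteq> 0" using x that by (auto simp: d_def collision_free_iff[OF m])
    have lin: "((\<lambda>y. y $ i - y $ j) has_derivative (\<lambda>h. h $ i - h $ j)) (at x)"
      by (intro has_derivative_diff bounded_linear.has_derivative[OF bounded_linear_vec_nth] has_derivative_ident)
    have "((\<lambda>y. norm (y $ i - y $ j)) has_derivative (\<lambda>h. (h $ i - h $ j) \<bullet> sgn d)) (at x)"
      unfolding d_def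
      by (rule has_derivative_compose[OF lin has_derivative_norm]) (use d in \<open>simp add: d_def\<close>)
    then have "((\<lambda>y. m i * m j * inverse (norm (y $ i - y $ j))) has_derivative
        (\<lambda>h. m i * m j * - (inverse (norm d) * ((h $ i - h $ j) \<bullet> sgn d) * inverse (norm d)))) (at x)"
      unfolding d_def
      by (intro has_derivative_mult_right Deriv.has_derivative_inverse) (use d in \<open>simp add: d_def\<close>)
    moreover have "m i * m j * - (inverse (norm d) * ((h $ i - h $ j) \<bullet> sgn d) * inverse (norm d)) =
        f h i j + f h j i" for h
    proof -
      have "coulomb (x $ j - x $ i) = - coulomb d" "coulomb (x $ i - x $ j) = coulomb d"
        using coulomb_minus[of d] by (simp_all add: d_def)
      then have "f h i j + f h j i = m i * m j * - (coulomb d \<bullet> (h $ i - h $ j))"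
        by (simp add: f_def algebra_simps)
      also have "coulomb d \<bullet> (h $ i - h $ j) =
          inverse (norm d) * ((h $ i - h $ j) \<bullet> sgn d) * inverse (norm d)"
        using d by (simp add: coulomb_def sgn_div_norm inner_commute power3_eq_cube field_simps)
      finally show ?thesis by simp
    qed
    ultimately show ?thesis by simp
  qed
  have "((\<lambda>y. \<Sum>(i, j)\<in>{(i, j). i < j}. m i * m j * inverse (norm (y $ i - y $ j))) has_derivative
      (\<lambda>h. \<Sum>(i, j)\<in>{(i, j). i < j}. f h i j + f h j i)) (at x)"
    unfolding case_prod_unfold by (rule has_derivative_sum) (use pair in auto)
  moreover have "(\<Sum>(i, j)\<in>{(i, j). i < j}. f h i j + f h j i) = mass_inner m (newton_field m x) h" for h
  proof -
    have "(\<Sum>(i, j)\<in>{(i, j). i < j}. f h i j + f h j i) = (\<Sum>i\<in>UNIV. \<Sum>j\<in>UNIV. f h i j)"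
      by (rule sum_ordered_pairs) (simp add: f_def coulomb_def)
    also have "\<dots> = mass_inner m (newton_field m x) h"
      by (simp add: mass_inner_def newton_field_def f_def inner_sum_left sum_distrib_left mult.assoc)
    finally show ?thesis .
  qed
  ultimately have "((\<lambda>y. \<Sum>(i, j)\<in>{(i, j). i < j}. m i * m j * inverse (norm (y $ i - y $ j))) has_derivative
      mass_inner m (newton_field m x)) (at x)"
    by simp
  then show ?thesis
    unfolding has_mass_gradient_def
    by (rule has_derivative_transform_within_open[OF _ open_collision_free[OF m] x])
      (simp add: newton_potential_collision_free[OF m])
qed

section \<open>Angular momentum\<close>

text \<open>
  The space of bivectors carries only a vector space structure, not a topology. Limits and
  derivatives of the angular momentum are therefore taken componentwise, for the real numbers
  obtained by evaluating it at two vectors \<open>u\<close> and \<open>w\<close>.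
\<close>

lemma bivector_form_angular_momentum:
  "bivector_form (angular_momentum m x v) u w =
    (\<Sum>i\<in>UNIV. m i * ((x $ i \<bullet> u) * (v $ i \<bullet> w) - (x $ i \<bullet> w) * (v $ i \<bullet> u)))"
  by (simp add: angular_momentum_def bivector_form_sum scaleR_bivector.rep_eq wedge.rep_eq)

lemma angular_momentum_eq_0_iff:
  "angular_momentum m x v = 0 \<longleftrightarrow> (\<forall>u w. bivector_form (angular_momentum m x v) u w = 0)"
  by (simp add: zero_bivector.rep_eq fun_eq_iff flip: bivector_form_inject)

lemma bounded_bilinear_angular_momentum_component:
  "bounded_bilinear (\<lambda>x v. bivector_form (angular_momentum m x v) u w)"
  unfolding bilinear_conv_bounded_bilinear[symmetric] bilinear_def linear_iff bivector_form_angular_momentum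
  by (simp add: inner_add_left sum.distrib[symmetric] sum_distrib_left algebra_simps)

lemma angular_momentum_self: "angular_momentum m x x = 0"
  by (simp add: angular_momentum_def wedge_self)

text \<open>
  The internal forces exert no torque: the force of \<open>j\<close> on \<open>i\<close> is a multiple, symmetric in \<open>i\<close> and \<open>j\<close>, of
  \<open>x\<^sub>j - x\<^sub>i\<close>, and \<open>x\<^sub>i \<and> (x\<^sub>j - x\<^sub>i) = x\<^sub>i \<and> x\<^sub>j\<close> is antisymmetric.
\<close>

lemma angular_momentum_newton_field: "angular_momentum m x (newton_field m x) = 0"
  unfolding angular_momentum_eq_0_iff
proof (intro allI)
  fix u w
  define k where "k i j = m i * m j * inverse (norm (x $ j - x $ i) ^ 3)" for i j
  define b where "b i j = (x $ i \<bullet> u) * (x $ j \<bullet> w) - (x $ i \<bullet> w) * (x $ j \<bullet> u)" for i j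
  have k: "k j i = k i j" for i j by (simp add: k_def norm_minus_commute mult.commute)
  have b: "b j i = - b i j" for i j by (simp add: b_def mult.commute)
  have "m i * ((x $ i \<bullet> u) * (newton_field m x $ i \<bullet> w) - (x $ i \<bullet> w) * (newton_field m x $ i \<bullet> u))
      = (\<Sum>j\<in>UNIV. k i j * b i j)" for i
    by (simp add: newton_field_def coulomb_def inner_sum_left inner_diff_left sum_distrib_left
        k_def b_def algebra_simps flip: sum_subtractf)
  then have "bivector_form (angular_momentum m x (newton_field m x)) u w =
      (\<Sum>i\<in>UNIV. \<Sum>j\<in>UNIV. k i j * b i j)"
    by (simp add: bivector_form_angular_momentum)
  moreover have "(\<Sum>i\<in>UNIV. \<Sum>j\<in>UNIV. k i j * b i j) = (\<Sum>j\<in>UNIV. \<Sum>i\<in>UNIV. k i j * b i j)"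
    by (rule sum.swap)
  moreover have "(\<Sum>j\<in>UNIV. \<Sum>i\<in>UNIV. k i j * b i j) = - (\<Sum>j\<in>UNIV. \<Sum>i\<in>UNIV. k j i * b j i)"
    unfolding sum_negf[symmetric] by (intro sum.cong refl) (metis b k mult_minus_right minus_minus)
  ultimately show "bivector_form (angular_momentum m x (newton_field m x)) u w = 0"
    by linarith
qed

text \<open>
  The moment \<open>\<beta>(x, v)\<close> is constant because \<open>\<beta>(v, v) + \<beta>(x, G x) = 0\<close>. Its expansion at infinity has only the
  unbounded terms \<open>t \<beta>(a, a)\<close> and \<open>ln t \<beta>(G a, a)\<close>, both zero, and the bounded term
  \<open>\<beta>(a, G a)\<close>, also zero; the other terms tend to \<open>0\<close>.
\<close>

lemma moment_of_central_force_vanishes: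
  fixes \<beta> :: "'a::real_normed_vector \<Rightarrow> 'a \<Rightarrow> real"
  assumes \<beta>: "bounded_bilinear \<beta>" and alt: "\<And>y. \<beta> y y = 0" and central: "\<And>y. \<beta> y (G y) = 0"
    and x': "\<And>t. t > T \<Longrightarrow> (x has_vector_derivative v t) (at t)"
    and v': "\<And>t. t > T \<Longrightarrow> (v has_vector_derivative G (x t)) (at t)"
    and x: "\<And>t. x t = t *\<^sub>R a - ln t *\<^sub>R G a + e t"
    and v: "\<And>t. v t = a - (1 / t) *\<^sub>R G a + f t"
    and e: "(e \<longlongrightarrow> 0) at_top" and f: "((\<lambda>t. t *\<^sub>R f t) \<longlongrightarrow> 0) at_top"
    and t: "t > T"
  shows "\<beta> (x t) (v t) = 0"
proof -
  interpret bounded_bilinear \<beta> by (rule \<beta>)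
  have anti: "\<beta> z y = - \<beta> y z" for y z
    using alt[of "y + z"] alt[of y] alt[of z] unfolding add_left add_right by linarith
  have "\<beta> (x s) (v s) = \<beta> (x t) (v t)" if s: "s > T" for s
  proof -
    have "((\<lambda>s. \<beta> (x s) (v s)) has_vector_derivative 0) (at s within {T<..})" if "s \<in> {T<..}" for s
    proof -
      have "((\<lambda>s. \<beta> (x s) (v s)) has_vector_derivative (\<beta> (x s) (G (x s)) + \<beta> (v s) (v s))) (at s)"
        using that by (intro has_vector_derivative x' v') auto
      then show ?thesis
        by (simp add: alt central has_vector_derivative_at_within)
    qed
    then obtain c where "\<And>s. s \<in> {T<..} \<Longrightarrow> \<beta> (x s) (v s) = c"
      using has_vector_derivative_zero_constant[of "{T<..}" "\<lambda>s. \<beta> (x s) (v s)"] by auto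
    then show ?thesis using s t by simp
  qed
  then have "\<forall>\<^sub>F s in at_top. \<beta> (x s) (v s) = \<beta> (x t) (v t)"
    by (rule eventually_mono[OF eventually_gt_at_top])
  then have const: "((\<lambda>s. \<beta> (x s) (v s)) \<longlongrightarrow> \<beta> (x t) (v t)) at_top"
    by (rule tendsto_eventually)

  \<comment> \<open>What remains of the expansion after the vanishing terms are removed.\<close>
  define h where "h s = \<beta> a (s *\<^sub>R f s) - (ln s / s) * \<beta> (G a) (s *\<^sub>R f s) + \<beta> (e s) (v s)" for s
  have "\<beta> (x s) (v s) = h s" if "s > 0" for s
  proof -
    have "\<beta> (x s) (v s) = \<beta> (s *\<^sub>R a - ln s *\<^sub>R G a) (v s) + \<beta> (e s) (v s)"
      by (simp add: x add_left)
    moreover have "\<beta> (s *\<^sub>R a - ln s *\<^sub>R G a) (v s) = \<beta> a (s *\<^sub>R f s) - (ln s / s) * \<beta> (G a) (s *\<^sub>R f s)"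
      using that anti[of "G a" a] by (simp add: v add_left add_right diff_left diff_right scaleR_left scaleR_right
          alt central right_diff_distrib)
    ultimately show ?thesis by (simp add: h_def)
  qed
  then have "\<forall>\<^sub>F s in at_top. h s = \<beta> (x s) (v s)"
    by (intro eventually_mono[OF eventually_gt_at_top[of 0]]) simp
  moreover have "(h \<longlongrightarrow> 0) at_top"
  proof -
    have inv: "((\<lambda>s::real. 1 / s) \<longlongrightarrow> 0) at_top"
      by (rule tendsto_divide_0[OF tendsto_const]) (simp add: filterlim_at_top_imp_at_infinity filterlim_ident)
    have "((\<lambda>s. (1 / s) *\<^sub>R (s *\<^sub>R f s)) \<longlongrightarrow> 0 *\<^sub>R 0) at_top"
      by (intro tendsto_scaleR inv f)
    moreover have "\<forall>\<^sub>F s in at_top. (1 / s) *\<^sub>R (s *\<^sub>R f s) = f s"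
      using eventually_gt_at_top[of 0] by eventually_elim simp
    ultimately have "(f \<longlongrightarrow> 0) at_top"
      by (simp add: tendsto_cong)
    then have "(v \<longlongrightarrow> a - 0 *\<^sub>R G a + 0) at_top"
      unfolding v by (intro tendsto_intros inv)
    then have "(h \<longlongrightarrow> \<beta> a 0 - 0 * \<beta> (G a) 0 + \<beta> 0 (a - 0 *\<^sub>R G a + 0)) at_top"
      unfolding h_def by (intro tendsto_intros tendsto ln_x_over_x_tendsto_0 e f)
    then show ?thesis by (simp add: zero_left zero_right)
  qed
  ultimately have "((\<lambda>s. \<beta> (x s) (v s)) \<longlongrightarrow> 0) at_top"
    by (simp add: tendsto_cong)
  with const show ?thesis
    using tendsto_unique trivial_limit_at_top_linorder by blast
qed

section \<open>Hyperbolic motions with zero angular momentum\<close>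

theorem corollary1p2:
  fixes m :: "'n::{finite,linorder} \<Rightarrow> real"
    and a :: "'e::euclidean_space ^ 'n::{finite,linorder}"
  assumes "CARD('n) \<ge> 2"
    and "DIM('e) \<ge> 2"
    and "\<And>i. m i > 0"
    and "a \<in> collision_free m"
  shows "\<exists>t0 (x :: real \<Rightarrow> 'e ^ 'n::{finite,linorder}).
           hyperbolic_motion m t0 x \<and>
           (\<forall>t>t0. angular_momentum m (x t) (velocity x t) = 0) \<and>
           (velocity x \<longlongrightarrow> a) at_top"
proof -
  note m = assms(3) and a = assms(4)
  let ?G = "newton_field m :: 'e ^ 'n::{finite,linorder} \<Rightarrow> _"
  obtain \<delta> L where \<delta>: "\<delta> > 0" and ball: "cball a \<delta> \<subseteq> collision_free m"
    and lip: "L-lipschitz_on (cball a \<delta>) ?G"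
    by (rule newton_field_locally_lipschitz[OF m a])
  obtain T e f where T: "T > 0"
    and near: "\<And>t. t > T \<Longrightarrow> (1 / t) *\<^sub>R (t *\<^sub>R a - ln t *\<^sub>R ?G a + e t) \<in> cball a \<delta>"
    and e': "\<And>t. t > T \<Longrightarrow> (e has_vector_derivative f t) (at t)"
    and f': "\<And>t. t > T \<Longrightarrow>
      (f has_vector_derivative ?G (t *\<^sub>R a - ln t *\<^sub>R ?G a + e t) - inverse (t\<^sup>2) *\<^sub>R ?G a) (at t)"
    and e: "(e \<longlongrightarrow> 0) at_top" and f: "((\<lambda>t. t *\<^sub>R f t) \<longlongrightarrow> 0) at_top"
  proof (rule inverse_square_asymptotic_solution[OF newton_field_scaleR lip \<delta>], goal_cases)
    case (2 T e f)
    show ?case by (rule 2(1)[OF 2(2-7)])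
  qed simp
  define x where "x t = t *\<^sub>R a - ln t *\<^sub>R ?G a + e t" for t
  define v where "v t = a - (1 / t) *\<^sub>R ?G a + f t" for t
  have x': "(x has_vector_derivative v t) (at t)" if "t > T" for t
  proof -
    have "((\<lambda>t. t *\<^sub>R a - ln t *\<^sub>R ?G a + e t) has_vector_derivative 1 *\<^sub>R a - (1 / t) *\<^sub>R ?G a + f t) (at t)"
    proof (intro has_vector_derivative_add has_vector_derivative_diff e' that)
      show "((\<lambda>t. t *\<^sub>R a) has_vector_derivative 1 *\<^sub>R a) (at t)"
        using has_vector_derivative_scaleR[OF DERIV_ident has_vector_derivative_const] by simp
      have "(ln has_real_derivative 1 / t) (at t)"
        using T that by (auto intro!: derivative_eq_intros)
      then show "((\<lambda>t. ln t *\<^sub>R ?G a) has_vector_derivative (1 / t) *\<^sub>R ?G a) (at t)"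
        using has_vector_derivative_scaleR[OF _ has_vector_derivative_const] by fastforce
    qed
    then show ?thesis unfolding x_def v_def by simp
  qed
  have v': "(v has_vector_derivative ?G (x t)) (at t)" if "t > T" for t
  proof -
    have "((\<lambda>t. 1 / t) has_real_derivative - inverse (t\<^sup>2)) (at t)"
      using T that by (auto intro!: derivative_eq_intros simp: power2_eq_square field_simps)
    then have "((\<lambda>t. (1 / t) *\<^sub>R ?G a) has_vector_derivative - inverse (t\<^sup>2) *\<^sub>R ?G a) (at t)"
      using has_vector_derivative_scaleR[OF _ has_vector_derivative_const] by fastforce
    then have "((\<lambda>t. a - (1 / t) *\<^sub>R ?G a + f t) has_vector_derivative
        0 - - inverse (t\<^sup>2) *\<^sub>R ?G a + (?G (x t) - inverse (t\<^sup>2) *\<^sub>R ?G a)) (at t)"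
      unfolding x_def
      by (intro has_vector_derivative_add has_vector_derivative_diff has_vector_derivative_const f' that)
    then show ?thesis unfolding v_def by simp
  qed
  have velocity: "velocity x t = v t" if "t > T" for t
    by (rule vector_derivative_at[OF x'[OF that]])

  have "newton_solution m {T<..} x"
    unfolding newton_solution_def
  proof (intro ballI conjI exI)
    fix t assume "t \<in> {T<..}"
    then have t: "t > T" by simp
    \<comment> \<open>Being collision-free is invariant under scaling, so it suffices that \<open>x(t)/t\<close> is near \<open>a\<close>.\<close>
    have "(1 / t) *\<^sub>R x t \<in> collision_free m"
      using near[OF t] ball by (auto simp: x_def)
    then show free: "x t \<in> collision_free m"
      using T t by (simp add: collision_free_iff[OF m])
    show "x differentiable (at t)"
      using x'[OF t] by (rule differentiableI_vector)
    show "has_mass_gradient m (\<lambda>y. real_of_ereal (newton_potential m y)) (?G (x t)) (x t)"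
      by (rule newton_field_is_mass_gradient[OF m free])
    show "(velocity x has_vector_derivative ?G (x t)) (at t)"
      by (rule has_vector_derivative_transform_within_open[OF v'[OF t], of "{T<..}"])
        (use t velocity in auto)
  qed

  moreover have lim: "(velocity x \<longlongrightarrow> a) at_top"
  proof -
    have inv: "((\<lambda>s::real. 1 / s) \<longlongrightarrow> 0) at_top"
      by (rule tendsto_divide_0[OF tendsto_const]) (simp add: filterlim_at_top_imp_at_infinity filterlim_ident)
    have "((\<lambda>s. a - (1 / s) *\<^sub>R ?G a + (1 / s) *\<^sub>R (s *\<^sub>R f s)) \<longlongrightarrow> a - 0 *\<^sub>R ?G a + 0 *\<^sub>R 0) at_top"
      by (intro tendsto_intros inv f)
    moreover have "\<forall>\<^sub>F s in at_top. velocity x s = a - (1 / s) *\<^sub>R ?G a + (1 / s) *\<^sub>R (s *\<^sub>R f s)"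
      using eventually_gt_at_top[of T]
      by eventually_elim (use T in \<open>simp add: velocity v_def\<close>)
    ultimately show ?thesis by (simp add: tendsto_cong)
  qed
  then have "\<forall>i. ((\<lambda>t. velocity x t $ i) \<longlongrightarrow> a $ i) at_top"
    by (intro allI tendsto_vec_nth)
  moreover have "\<forall>i j. i \<noteq> j \<longrightarrow> a $ i \<noteq> a $ j"
    using a by (simp add: collision_free_iff[OF m])
  ultimately have "hyperbolic_motion m T x"
    unfolding hyperbolic_motion_def by blast

  moreover have "angular_momentum m (x t) (velocity x t) = 0" if t: "t > T" for t
    unfolding angular_momentum_eq_0_iff velocity[OF t]
    by (intro allI moment_of_central_force_vanishes[OF bounded_bilinear_angular_momentum_component _ _ x' v' x_def v_def e f t])
      (simp_all add: angular_momentum_self angular_momentum_newton_field zero_bivector.rep_eq)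
  ultimately show ?thesis using lim by blast
qed

end
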